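(* Let $f:H\to\mathbb{R}$ be $\mu$-strongly convex and $L$-smooth ($\mu,L>0$), with minimizer $x^*$ and minimum value $f^*$. Set $$h=\frac{1}{\sqrt L},\qquad \gamma\in[1,2],\qquad \alpha=3\sqrt{\mu\gamma/2}.$$ Given $x_0,y_0\in H$, let $(x_k)$ and $(y_k)$ be generated, for $k\ge 0$, by $$y_{k+1}=x_k-h^2\nabla f(x_k),\qquad x_{k+1}=y_{k+1}+\frac{1}{1+\alpha h}(y_{k+1}-y_k)+\left(\frac{\gamma}{1+\alpha h}-1\right)(y_{k+1}-x_k).$$ If $y_0=-\left(\gamma-\frac{\frac13\alpha h}{1+\frac23\alpha h}\right)h^2\nabla f(x_0)+x_0$, then for every $k\ge 1$, $$f(y_k)-f^*\le C(1+\rho)^{-k+1},$$ where $\rho=\frac{\sqrt{2q\gamma}}{1+\sqrt{2q\gamma}}$, $q=\mu/L$, and $$C=\frac{1}{2-\sqrt2}\left(3+\sqrt{2/(q\gamma)}\right)\left[\mu\|x_0-x^*\|^2+\left(f(x_0)-f^*\right)\right].$$ Moreover, $\sum_{k=0}^\infty(1+\rho)^k\|\nabla f(x_k)\|^2<\infty$, and so $\|\nabla f(x_k)\|^2=o\big((1+\rho)^{-k}\big)$ as $k\to\infty$.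
   Context: $H$ is a real Hilbert space with inner product $\langle\cdot,\cdot\rangle$ and norm $\|\cdot\|$. $f$ is $L$-smooth if it is differentiable and $\nabla f$ is Lipschitz-continuous with constant $L$. A differentiable $f$ is $\mu$-strongly convex if $f(y)\ge f(x)+\langle\nabla f(x),y-x\rangle+\frac{\mu}{2}\|x-y\|^2$ for all $x,y\in H$. *)

theory Defs
  imports "HOL-Analysis.Analysis" "HOL-Library.Landau_Symbols"
begin

text \<open>
  On a Hilbert space the Riesz representation theorem makes \<open>gradient f x\<close> well defined
  whenever \<open>f\<close> is Frechet differentiable at \<open>x\<close>; elsewhere it is unspecified.
\<close>

definition gradient :: "('a::{real_inner, complete_space} \<Rightarrow> real) \<Rightarrow> 'a \<Rightarrow> 'a" where
  "gradient f x = (THE D. GDERIV f x :> D)"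

definition smooth_with :: "real \<Rightarrow> ('a::{real_inner, complete_space} \<Rightarrow> real) \<Rightarrow> bool" where
  "smooth_with L f \<longleftrightarrow>
     (\<forall>x. f differentiable (at x)) \<and> L-lipschitz_on UNIV (gradient f)"

definition strongly_convex :: "real \<Rightarrow> ('a::{real_inner, complete_space} \<Rightarrow> real) \<Rightarrow> bool" where
  "strongly_convex \<mu> f \<longleftrightarrow>
     (\<forall>x. f differentiable (at x)) \<and>
     (\<forall>x y. f y \<ge> f x + inner (gradient f x) (y - x) + \<mu> / 2 * (norm (x - y))\<^sup>2)"

end

theory Submission
  imports Defs
begin

text \<open>
  Write \<open>l = \<alpha> h / 3 = h sqrt (\<mu> \<gamma> / 2)\<close>, so that \<open>1 + \<rho> = (1 + 4 l) / (1 + 2 l)\<close>, and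
  rescale by \<open>h\<^sup>2\<close>: \<open>G\<^sub>k = h\<^sup>2 \<nabla>f(x\<^sub>k)\<close>, \<open>w\<^sub>k = x\<^sub>k\<^sub>+\<^sub>1 - y\<^sub>k\<^sub>+\<^sub>1\<close>,
  \<open>\<Phi>\<^sub>k = h\<^sup>2 (f(x\<^sub>k) - f\<^sup>*) - |G\<^sub>k|\<^sup>2 / 2\<close>, which dominates \<open>h\<^sup>2 (f(y\<^sub>k\<^sub>+\<^sub>1) - f\<^sup>*)\<close>.
  The energy
  \<open>E\<^sub>k = (\<gamma> - a) \<Phi>\<^sub>k + |2 l (x\<^sub>k\<^sub>+\<^sub>1 - x\<^sup>*) + w\<^sub>k|\<^sup>2 / 2 - l\<^sup>2 / (1 + \<rho>) |x\<^sub>k\<^sub>+\<^sub>1 - x\<^sup>*|\<^sup>2\<close>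
  with \<open>a = 2 l / (\<gamma> (1 + 4 l))\<close> satisfies \<open>(1 + \<rho>) E\<^sub>k\<^sub>+\<^sub>1 + c |G\<^sub>k\<^sub>+\<^sub>1|\<^sup>2 \<le> E\<^sub>k\<close> for some \<open>c > 0\<close>,
  and it dominates a multiple of order \<open>l\<close> of \<open>\<Phi>\<^sub>k\<close>, whence the factor \<open>3 + 1 / l\<close> in \<open>C\<close>.
  The choice of \<open>y\<^sub>0\<close> makes \<open>2 l (x\<^sub>1 - x\<^sup>*) + w\<^sub>0 = 2 l (x\<^sub>0 - x\<^sup>*)\<close>, which bounds \<open>E\<^sub>0\<close>.
\<close>

section \<open>Inequalities for strongly convex and smooth functions\<close>

lemma strongly_convex_lower:
  "strongly_convex \<mu> f \<Longrightarrow> f x + inner (gradient f x) (y - x) + \<mu> / 2 * (norm (x - y))\<^sup>2 \<le> f y"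
  by (auto simp: strongly_convex_def)

lemma strongly_convex_subgradient:
  assumes "strongly_convex \<mu> f" "\<mu> \<ge> 0"
  shows "f x + inner (gradient f x) (y - x) \<le> f y"
  using strongly_convex_lower[OF assms(1), of x y] assms(2)
  by (smt (verit) divide_nonneg_nonneg mult_nonneg_nonneg zero_le_power2)

text \<open>A subgradient at a point of differentiability represents the derivative, so the Riesz
  representation theorem is not needed.\<close>

lemma strongly_convex_has_derivative:
  assumes "strongly_convex \<mu> f" "\<mu> \<ge> 0"
  shows "(f has_derivative inner (gradient f x)) (at x)"
proof -
  let ?g = "gradient f x"
  obtain f' where f': "(f has_derivative f') (at x)"
    using assms(1) unfolding strongly_convex_def differentiable_def by blast
  have "((\<lambda>z. f z - inner ?g z) has_derivative (\<lambda>v. f' v - inner ?g v)) (at x)"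
    by (intro derivative_intros f')
  \<comment> \<open>Tilting \<open>f\<close> by its subgradient makes \<open>x\<close> a global
    minimum, where the derivative must vanish.\<close>
  moreover have "f x - inner ?g x \<le> f z - inner ?g z" for z
    using strongly_convex_subgradient[OF assms, of x z] by (simp add: inner_diff_right)
  ultimately have "(\<lambda>v. f' v - inner ?g v) = (\<lambda>v. 0)"
    using differential_zero_maxmin[of x UNIV] by auto
  then have "f' = inner ?g"
    by (auto simp: fun_eq_iff)
  with f' show ?thesis by simp
qed

text \<open>Along the segment, the Lipschitz bound and Cauchy-Schwarz make \<open>f\<close> minus
  its quadratic model nonincreasing.\<close>

lemma descent:
  assumes sc: "strongly_convex \<mu> f" "\<mu> \<ge> 0" and sm: "smooth_with L f"
  shows "f y \<le> f x + inner (gradient f x) (y - x) + L / 2 * (norm (y - x))\<^sup>2"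
proof -
  define v where "v = y - x"
  define \<phi> where "\<phi> t = f (x + t *\<^sub>R v) - t * inner (gradient f x) v - L / 2 * t\<^sup>2 * (norm v)\<^sup>2" for t
  have der: "(\<phi> has_real_derivative
      inner (gradient f (x + t *\<^sub>R v) - gradient f x) v - L * t * (norm v)\<^sup>2) (at t)" for t
  proof -
    have "((\<lambda>t. f (x + t *\<^sub>R v)) has_derivative
        (\<lambda>s. inner (gradient f (x + t *\<^sub>R v)) (s *\<^sub>R v))) (at t)"
      by (rule has_derivative_compose[OF _ strongly_convex_has_derivative[OF sc]])
        (auto intro!: derivative_eq_intros)
    then have "((\<lambda>t. f (x + t *\<^sub>R v)) has_real_derivative
        inner (gradient f (x + t *\<^sub>R v)) v) (at t)"
      by (simp add: has_field_derivative_def mult_commute_abs)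
    then show ?thesis
      unfolding \<phi>_def
      by (auto intro!: derivative_eq_intros simp: inner_diff_left)
  qed
  have "\<phi> 1 \<le> \<phi> 0"
  proof (rule DERIV_nonpos_imp_nonincreasing[of 0 1 \<phi>])
    fix t :: real assume t: "0 \<le> t" "t \<le> 1"
    have "norm (gradient f (x + t *\<^sub>R v) - gradient f x) \<le> L * norm (t *\<^sub>R v)"
      using lipschitz_onD[of L UNIV "gradient f" "x + t *\<^sub>R v" x] sm
      by (simp add: smooth_with_def dist_norm)
    then have "norm (gradient f (x + t *\<^sub>R v) - gradient f x) * norm v \<le> L * norm (t *\<^sub>R v) * norm v"
      by (simp add: mult_right_mono)
    with norm_cauchy_schwarz[of "gradient f (x + t *\<^sub>R v) - gradient f x" v]
    have "inner (gradient f (x + t *\<^sub>R v) - gradient f x) v \<le> L * t * (norm v)\<^sup>2"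
      using t by (simp add: power2_eq_square mult.assoc)
    with der[of t] show "\<exists>y. (\<phi> has_real_derivative y) (at t) \<and> y \<le> 0"
      by force
  qed simp
  then show ?thesis
    by (simp add: \<phi>_def v_def)
qed

text \<open>The step \<open>1 / L\<close> minimizes the quadratic upper model of
  \<open>descent\<close>.\<close>

lemma gradient_step_decrease:
  assumes "strongly_convex \<mu> f" "\<mu> \<ge> 0" "smooth_with L f" "L > 0"
  shows "f (x - (1 / L) *\<^sub>R gradient f x) \<le> f x - (norm (gradient f x))\<^sup>2 / (2 * L)"
proof -
  let ?g = "gradient f x"
  have "L / 2 * (norm ((1 / L) *\<^sub>R ?g))\<^sup>2 = (norm ?g)\<^sup>2 / (2 * L)"
    using assms(4) by (simp add: field_simps power2_eq_square)
  then show ?thesis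
    using descent[OF assms(1-3), of "x - (1 / L) *\<^sub>R ?g" x]
    by (simp add: power2_norm_eq_inner field_simps)
qed

text \<open>At an auxiliary point \<open>z\<close>, the tangent at \<open>x\<close> bounds
  \<open>f\<close> from below and the quadratic model at \<open>y\<close> bounds it from
  above.\<close>

lemma subgradient_cocoercive:
  assumes "strongly_convex \<mu> f" "\<mu> \<ge> 0" "smooth_with L f" "L > 0"
  shows "f x + inner (gradient f x) (y - x) + (norm (gradient f x - gradient f y))\<^sup>2 / (2 * L) \<le> f y"
proof -
  define e where "e = gradient f y - gradient f x"
  \<comment> \<open>This point minimizes the gap between model and tangent, so the comparison is
    sharpest there.\<close>
  define z where "z = y - (1 / L) *\<^sub>R e"
  have "f x + inner (gradient f x) (z - x) \<le> f z"
    by (rule strongly_convex_subgradient[OF assms(1,2)])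
  moreover have "inner (gradient f x) (z - x)
      = inner (gradient f x) (y - x) - inner (gradient f x) e / L"
    by (simp add: z_def inner_diff_right)
  moreover have "f z \<le> f y + inner (gradient f y) (z - y) + L / 2 * (norm (z - y))\<^sup>2"
    by (rule descent[OF assms(1-3)])
  moreover have "inner (gradient f y) (z - y) = - (inner (gradient f y) e / L)"
    by (simp add: z_def)
  moreover have "L / 2 * (norm (z - y))\<^sup>2 = (norm e)\<^sup>2 / (2 * L)"
    using assms(4) by (simp add: z_def power_mult_distrib field_simps power2_eq_square)
  moreover have "inner (gradient f y) e / L - inner (gradient f x) e / L = 2 * ((norm e)\<^sup>2 / (2 * L))"
    by (simp add: e_def inner_diff_left power2_norm_eq_inner diff_divide_distrib)
  moreover have "norm (gradient f x - gradient f y) = norm e"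
    by (simp add: e_def norm_minus_commute)
  ultimately show ?thesis by simp
qed

text \<open>A nonzero gradient would let a gradient step go below the minimum.\<close>

lemma gradient_at_minimizer:
  assumes "strongly_convex \<mu> f" "\<mu> \<ge> 0" "smooth_with L f" "L > 0" "\<forall>z. f x \<le> f z"
  shows "gradient f x = 0"
proof -
  have "(norm (gradient f x))\<^sup>2 / (2 * L) \<le> 0"
    using gradient_step_decrease[OF assms(1-4), of x] assms(5) by (smt (verit))
  then show ?thesis
    using assms(4) by (simp add: field_simps)
qed

lemma strongly_convex_growth:
  assumes "strongly_convex \<mu> f" "\<mu> \<ge> 0" "smooth_with L f" "L > 0" "\<forall>z. f x \<le> f z"
  shows "\<mu> / 2 * (norm (z - x))\<^sup>2 \<le> f z - f x"
  using strongly_convex_lower[OF assms(1), of x z] gradient_at_minimizer[OF assms]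
  by (simp add: norm_minus_commute)

section \<open>The energy: its decrease in one step and a lower bound for it\<close>

text \<open>In the iteration, \<open>e = y\<^sub>k\<^sub>+\<^sub>1 - x\<^sup>*\<close> and \<open>w = x\<^sub>k\<^sub>+\<^sub>1 - y\<^sub>k\<^sub>+\<^sub>1\<close>.\<close>

definition energy :: "real \<Rightarrow> real \<Rightarrow> real \<Rightarrow> 'a::real_inner \<Rightarrow> 'a \<Rightarrow> real" where
  "energy l \<gamma> \<Phi> e w = (\<gamma> - 2 * l / (\<gamma> * (1 + 4 * l))) * \<Phi>
     + (norm ((2 * l) *\<^sub>R (e + w) + w))\<^sup>2 / 2
     - l\<^sup>2 * (1 + 2 * l) / (1 + 4 * l) * (norm (e + w))\<^sup>2"

text \<open>
  The weight \<open>l\<^sup>2 / (1 + \<rho>)\<close> in the energy is the one for which no multiple of \<open>dv\<close> is left over;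
  \<open>dd\<close>, \<open>dg\<close>, \<open>dv\<close>, \<open>vv\<close>, \<open>vg\<close>, \<open>gg\<close> stand for the inner products of the vectors in \<open>energy_step\<close>.
\<close>

lemma energy_step_identity:
  fixes l \<gamma> a F dd dg dv vv vg gg :: real
  assumes "l > 0" "\<gamma> > 0"
  defines "s \<equiv> 1 + 2 * l" and "t \<equiv> 1 + 4 * l"
  shows "(\<gamma> - a) * (F - gg / 2 + gg - ((1 + 3 * l) * vg + (1 + \<gamma>) * gg))
      + (4 * l\<^sup>2 * dd + (1 + 3 * l)\<^sup>2 * vv + (1 + \<gamma>)\<^sup>2 * gg + 4 * l * (1 + 3 * l) * dv
          + 4 * l * (1 + \<gamma>) * dg + 2 * (1 + 3 * l) * (1 + \<gamma>) * vg) / 2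
      - l\<^sup>2 * s / t * dd
      - t / s * ((\<gamma> - a) * (F - gg / 2)
        + (4 * l\<^sup>2 * dd + s\<^sup>2 * vv + gg + 4 * l * s * dv + 4 * l * dg + 2 * s * vg) / 2
        - l\<^sup>2 * s / t * (dd + 2 * dv + vv))
    = 2 * l / s * (\<gamma> - a) * (dg - F - l\<^sup>2 / \<gamma> * dd)
      + 2 * l / s * (a + 2 * l * (\<gamma> - 1)) * (dg - 2 * l\<^sup>2 / \<gamma> * dd)
      + 2 * l ^ 3 / s * ((a + 4 * l * (\<gamma> - 1)) / \<gamma> - 2 * l / t) * dd
      + (3 / 2 * l\<^sup>2 * vv - (l - a * (1 + 3 * l)) * vg
         + (\<gamma> * (2 - \<gamma>) / 2 + a * (\<gamma> - l / s) + l * (\<gamma> - 1) / s) * gg)"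
proof -
  have "s > 0" "t > 0" using assms by auto
  then show ?thesis
    using assms(2) 
    \<comment> \<open>Clearing denominators while \<open>s\<close> and \<open>t\<close> are opaque
      leaves a polynomial identity.\<close>
    apply (simp add: divide_simps)
    apply (simp add: s_def t_def)
    by algebra
qed

text \<open>Primed data belong to index \<open>k\<close>, unprimed data to \<open>k + 1\<close>, and
  \<open>d\<close> is \<open>x (k + 1) - xstar\<close>. After \<open>decr\<close> has been applied,
  \<open>energy_step_identity\<close> splits the energy drop into multiples of the slacks in
  \<open>sc\<close> and \<open>mono\<close>, a nonnegative multiple of \<open>dd\<close>, and a
  quadratic form in \<open>v\<close> and \<open>g\<close> that still leaves a positive multiple of
  \<open>gg\<close>.\<close>

lemma energy_step:
  fixes d v g g' :: "'a::real_inner" and l \<gamma> F F' :: real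
  assumes l: "l > 0" and \<gamma>: "1 \<le> \<gamma>" "\<gamma> \<le> 2"
    and w': "w' = (1 + 3 * l) *\<^sub>R v + (1 + \<gamma>) *\<^sub>R g"
    and decr: "F - F' \<le> inner g (w' - g') - (norm (g - g'))\<^sup>2 / 2"
    and sc: "F + l\<^sup>2 / \<gamma> * (norm d)\<^sup>2 \<le> inner g d"
    and mono: "2 * l\<^sup>2 / \<gamma> * (norm d)\<^sup>2 \<le> inner g d"
  shows "(1 + 4 * l) / (1 + 2 * l) * energy l \<gamma> (F - (norm g)\<^sup>2 / 2) (d - g) (v + g)
      + 2 * l / (3 * \<gamma> * (1 + 4 * l)) * (norm g)\<^sup>2
    \<le> energy l \<gamma> (F' - (norm g')\<^sup>2 / 2) (d - w') w'"
proof -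
  define s t a where "s = 1 + 2 * l" and "t = 1 + 4 * l" and "a = 2 * l / (\<gamma> * t)"
  define dd dg dv vv vg gg where "dd = inner d d" and "dg = inner d g" and "dv = inner d v"
    and "vv = inner v v" and "vg = inner v g" and "gg = inner g g"
  note atoms = dd_def dg_def dv_def vv_def vg_def gg_def
  have pos: "s > 0" "t > 0" using l by (auto simp: s_def t_def)
  have a0: "0 < a" using l \<gamma> pos by (simp add: a_def)
  have a_le: "a \<le> 1 / 2"
  proof -
    have "4 * l \<le> \<gamma> * t"
      using l \<gamma> mult_mono[of 1 \<gamma> "4 * l" t] by (simp add: t_def)
    then show ?thesis using \<gamma> pos by (simp add: a_def divide_simps)
  qed
  have ls: "l / s \<le> 1 / 2" using l by (simp add: s_def divide_simps)
  define G where "G = \<gamma> * (2 - \<gamma>) / 2 + a * (\<gamma> - l / s) + l * (\<gamma> - 1) / s"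
  have G: "G \<ge> \<gamma> * (2 - \<gamma>) / 2 + a / 2"
  proof -
    have "a * (1 / 2) \<le> a * (\<gamma> - l / s)"
      using a0 ls \<gamma> by (intro mult_left_mono) auto
    moreover have "0 \<le> l * (\<gamma> - 1) / s" using l \<gamma> pos by simp
    ultimately show ?thesis unfolding G_def by linarith
  qed
  \<comment> \<open>The \<open>vg\<close> coefficient is \<open>l * c\<close>. Its factor
    \<open>l\<close> matches the \<open>l\<^sup>2\<close> at \<open>vv\<close>, so the discriminant
    condition \<open>c\<^sup>2 \<le> 6 * G\<close> is free of that scale.\<close>
  define c where "c = a - (2 - \<gamma>) / \<gamma>"
  have c: "l - a * (1 + 3 * l) = l * c"
  proof -
    have "a * \<gamma> * t = 2 * l" using \<gamma> pos by (simp add: a_def)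
    moreover have "c * \<gamma> = a * \<gamma> - (2 - \<gamma>)" using \<gamma> by (simp add: c_def left_diff_distrib[of a])
    ultimately have "(l - a * (1 + 3 * l)) * \<gamma> = l * c * \<gamma>"
      unfolding t_def by algebra
    then show ?thesis using \<gamma> by simp
  qed
  \<comment> \<open>Both \<open>a\<close> and \<open>(2 - \<gamma>) / \<gamma>\<close> lie in the
    unit interval: the cross term is dropped and each square is bounded by its base.\<close>
  have c2: "c\<^sup>2 \<le> 2 * G"
  proof -
    have *: "0 \<le> (2 - \<gamma>) / \<gamma>" "(2 - \<gamma>) / \<gamma> \<le> 1" using \<gamma> by (auto simp: divide_simps)
    have "c\<^sup>2 \<le> a\<^sup>2 + ((2 - \<gamma>) / \<gamma>)\<^sup>2"
      using mult_nonneg_nonneg[OF less_imp_le[OF a0] *(1)] by (simp add: c_def power2_diff)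
    also have "a\<^sup>2 \<le> a" using a0 a_le by (simp add: power2_eq_square)
    also have "((2 - \<gamma>) / \<gamma>)\<^sup>2 \<le> (2 - \<gamma>) / \<gamma>" using * mult_left_le[OF *(2,1)] by (simp only: power2_eq_square)
    also have "\<dots> \<le> \<gamma> * (2 - \<gamma>)"
    proof -
      have "(2 - \<gamma>) / \<gamma> \<le> (2 - \<gamma>) / 1" using \<gamma> by (intro divide_left_mono) auto
      also have "\<dots> \<le> \<gamma> * (2 - \<gamma>)" using \<gamma> mult_right_mono[of 1 \<gamma> "2 - \<gamma>"] by simp
      finally show ?thesis .
    qed
    finally show ?thesis using G by simp
  qed
  \<comment> \<open>One sixth of the square of \<open>3 l v - c g\<close>; since \<open>c2\<close>
    gives more than the discriminant condition, \<open>a / 3 * gg\<close> can be kept.\<close>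
  have quad: "a / 3 * gg \<le> 3 / 2 * l\<^sup>2 * vv - (l - a * (1 + 3 * l)) * vg + G * gg"
  proof -
    have "0 \<le> inner ((3 * l) *\<^sub>R v - c *\<^sub>R g) ((3 * l) *\<^sub>R v - c *\<^sub>R g)"
      by simp
    also have "\<dots> = 9 * l\<^sup>2 * vv - 6 * l * c * vg + c\<^sup>2 * gg"
      by (simp add: atoms inner_diff_left inner_diff_right inner_commute power2_eq_square)
    finally have "0 \<le> 9 * l\<^sup>2 * vv - 6 * l * c * vg + c\<^sup>2 * gg" .
    moreover have "c\<^sup>2 * gg + 2 * a * gg \<le> 6 * G * gg"
    proof -
      have "0 \<le> \<gamma> * (2 - \<gamma>)" using \<gamma> by simp
      then have "c\<^sup>2 + 2 * a \<le> 6 * G" using c2 G by linarith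
      then have "(c\<^sup>2 + 2 * a) * gg \<le> 6 * G * gg" by (intro mult_right_mono) (auto simp: atoms)
      then show ?thesis by (simp add: algebra_simps)
    qed
    ultimately show ?thesis by (simp add: c)
  qed
  \<comment> \<open>Up to the factor \<open>2 l / (\<gamma>\<^sup>2 t)\<close> the claim is
    \<open>\<gamma>\<^sup>2 \<le> 1 + 2 \<gamma> (\<gamma> - 1) t\<close>, which for
    \<open>t = 1\<close> reads \<open>(\<gamma> - 1)\<^sup>2 \<ge> 0\<close>.\<close>
  have K: "0 \<le> (a + 4 * l * (\<gamma> - 1)) / \<gamma> - 2 * l / t"
  proof -
    have "\<gamma>\<^sup>2 \<le> 1 + 2 * \<gamma> * (\<gamma> - 1)"
      using zero_le_power2[of "\<gamma> - 1"] by (simp add: power2_eq_square algebra_simps)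
    also have "\<dots> \<le> 1 + 2 * \<gamma> * (\<gamma> - 1) * t"
      using \<gamma> l mult_left_mono[of 1 t "2 * \<gamma> * (\<gamma> - 1)"] by (simp add: t_def)
    finally have "2 * l * \<gamma>\<^sup>2 / (\<gamma>\<^sup>2 * t) \<le> 2 * l * (1 + 2 * \<gamma> * (\<gamma> - 1) * t) / (\<gamma>\<^sup>2 * t)"
      using l \<gamma> pos by (intro divide_right_mono mult_left_mono) auto
    moreover have "2 * l * (1 + 2 * \<gamma> * (\<gamma> - 1) * t) / (\<gamma>\<^sup>2 * t) = (a + 4 * l * (\<gamma> - 1)) / \<gamma>"
      using \<gamma> pos by (simp add: a_def power2_eq_square divide_simps) (simp add: algebra_simps)
    ultimately show ?thesis using \<gamma> by simp
  qed
  have A: "0 \<le> \<gamma> - a" using \<gamma> a_le by simp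
  let ?R = "(1 + 3 * l) * vg + (1 + \<gamma>) * gg"
  \<comment> \<open>Here \<open>?R\<close> is \<open>inner g w'\<close>. The mixed terms in
    \<open>g\<close> and \<open>g'\<close> cancel, and the remaining square of \<open>g'\<close> is
    exactly the one subtracted in the energy.\<close>
  have "F - gg / 2 + gg - ?R \<le> F' - (norm g')\<^sup>2 / 2"
    using decr unfolding w' power2_norm_eq_inner
    by (simp add: atoms inner_diff_left inner_diff_right inner_add_right inner_commute field_simps)
  then have low: "(\<gamma> - a) * (F - gg / 2 + gg - ?R) \<le> (\<gamma> - a) * (F' - (norm g')\<^sup>2 / 2)"
    using A by (rule mult_left_mono)
  have p1: "0 \<le> 2 * l / s * (\<gamma> - a) * (dg - F - l\<^sup>2 / \<gamma> * dd)"
    using l pos A sc by (intro mult_nonneg_nonneg) (auto simp: atoms power2_norm_eq_inner inner_commute)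
  have p2: "0 \<le> 2 * l / s * (a + 2 * l * (\<gamma> - 1)) * (dg - 2 * l\<^sup>2 / \<gamma> * dd)"
    using l pos a0 \<gamma> mono by (intro mult_nonneg_nonneg add_nonneg_nonneg) (auto simp: atoms power2_norm_eq_inner inner_commute)
  have p3: "0 \<le> 2 * l ^ 3 / s * ((a + 4 * l * (\<gamma> - 1)) / \<gamma> - 2 * l / t) * dd"
    using l pos K by (intro mult_nonneg_nonneg) (auto simp: atoms)
  have "\<gamma> > 0" using \<gamma> by simp
  note id = energy_step_identity[of l \<gamma> a F gg vg dd vv dv dg, OF l this, folded s_def t_def, folded G_def]
  have e1: "energy l \<gamma> (F - (norm g)\<^sup>2 / 2) (d - g) (v + g)
     = (\<gamma> - a) * (F - gg / 2)
        + (4 * l\<^sup>2 * dd + s\<^sup>2 * vv + gg + 4 * l * s * dv + 4 * l * dg + 2 * s * vg) / 2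
        - l\<^sup>2 * s / t * (dd + 2 * dv + vv)"
  proof -
    have u: "(2 * l) *\<^sub>R (d - g + (v + g)) + (v + g) = (2 * l) *\<^sub>R d + s *\<^sub>R v + g"
      by (simp add: s_def algebra_simps)
    have e: "d - g + (v + g) = d + v" by simp
    have n1: "(norm ((2 * l) *\<^sub>R d + s *\<^sub>R v + g))\<^sup>2
        = 4 * l\<^sup>2 * dd + s\<^sup>2 * vv + gg + 4 * l * s * dv + 4 * l * dg + 2 * s * vg"
      unfolding power2_norm_eq_inner
      by (simp add: atoms inner_add_left inner_add_right inner_commute power2_eq_square algebra_simps)
    have n2: "(norm (d + v))\<^sup>2 = dd + 2 * dv + vv"
      unfolding power2_norm_eq_inner
      by (simp add: atoms inner_add_left inner_add_right inner_commute)
    have n3: "(norm g)\<^sup>2 = gg" by (simp add: atoms power2_norm_eq_inner)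
    show ?thesis
      unfolding energy_def u unfolding e n1 n2 n3 by (simp only: a_def t_def s_def)
  qed
  have e2: "energy l \<gamma> (F' - (norm g')\<^sup>2 / 2) (d - w') w'
     = (\<gamma> - a) * (F' - (norm g')\<^sup>2 / 2)
      + (4 * l\<^sup>2 * dd + (1 + 3 * l)\<^sup>2 * vv + (1 + \<gamma>)\<^sup>2 * gg + 4 * l * (1 + 3 * l) * dv
          + 4 * l * (1 + \<gamma>) * dg + 2 * (1 + 3 * l) * (1 + \<gamma>) * vg) / 2
      - l\<^sup>2 * s / t * dd"
  proof -
    have "(norm ((2 * l) *\<^sub>R d + w'))\<^sup>2
        = 4 * l\<^sup>2 * dd + (1 + 3 * l)\<^sup>2 * vv + (1 + \<gamma>)\<^sup>2 * gg + 4 * l * (1 + 3 * l) * dv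
          + 4 * l * (1 + \<gamma>) * dg + 2 * (1 + 3 * l) * (1 + \<gamma>) * vg"
      unfolding power2_norm_eq_inner w'
      by (simp add: atoms inner_add_left inner_add_right inner_commute power2_eq_square algebra_simps)
    then show ?thesis
      by (simp add: energy_def a_def t_def s_def atoms power2_norm_eq_inner)
  qed
  have e3: "2 * l / (3 * \<gamma> * (1 + 4 * l)) * (norm g)\<^sup>2 = a / 3 * gg"
    by (simp add: a_def t_def atoms power2_norm_eq_inner)
  show ?thesis
    unfolding e1 e2 e3 unfolding s_def[symmetric] t_def[symmetric]
    using id low p1 p2 p3 quad by linarith
qed

text \<open>After \<open>\<gamma> * \<eta> * \<Phi>\<close> is set aside, the growth hypothesis
  turns the rest of the \<open>\<Phi>\<close> term into \<open>B\<close> times the square of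
  \<open>e\<close>. With \<open>e + w = (U + e) / s\<close> a quadratic form in \<open>U\<close> and
  \<open>e\<close> remains, nonnegative by its discriminant.\<close>

lemma energy_lower:
  fixes e w :: "'a::real_inner" and l \<gamma> \<Phi> :: real
  assumes l: "l > 0" and \<gamma>: "1 \<le> \<gamma>"
    and \<Phi>: "l\<^sup>2 / \<gamma> * (norm e)\<^sup>2 \<le> \<Phi>"
  shows "\<gamma> * ((2 - sqrt 2) / (3 + 1 / l)) * \<Phi> \<le> energy l \<gamma> \<Phi> e w"
proof -
  define s t a where "s = 1 + 2 * l" and "t = 1 + 4 * l" and "a = 2 * l / (\<gamma> * t)"
  define \<eta> where "\<eta> = (2 - sqrt 2) / (3 + 1 / l)"
  define m where "m = l\<^sup>2 / (s * t)"
  define B where "B = (\<gamma> - a - \<gamma> * \<eta>) * (l\<^sup>2 / \<gamma>)"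
  define U where "U = (2 * l) *\<^sub>R (e + w) + w"
  have pos: "s > 0" "t > 0" using l by (auto simp: s_def t_def)
  have m: "0 < m" "m < 1 / 2"
    using l pos by (simp_all add: m_def divide_simps) (simp add: s_def t_def power2_eq_square algebra_simps add_pos_pos)
  \<comment> \<open>The polynomial is \<open>s * t - 2 * l\<^sup>2 = s * t * (1 - 2 * m)\<close>, so
    this bound is what yields \<open>m \<le> B * (1 - 2 * m)\<close>. For \<open>\<eta>\<close> the
    estimate \<open>2 - sqrt 2 \<le> 1\<close> is enough.\<close>
  have ratio: "a / \<gamma> + \<eta> \<le> 1 - 1 / (1 + 6 * l + 6 * l\<^sup>2)"
  proof -
    have "a \<le> 2 * l / t" using l \<gamma> pos by (simp add: a_def divide_simps)
    then have "a / \<gamma> \<le> 2 * l / t / 1" using \<gamma> l pos by (intro frac_le) auto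
    moreover have "\<eta> \<le> l / (1 + 3 * l)"
    proof -
      have "1 \<le> sqrt 2" by simp
      then have "\<eta> \<le> 1 / (3 + 1 / l)" unfolding \<eta>_def using l by (intro divide_right_mono) auto
      also have "\<dots> = l / (1 + 3 * l)" using l by (simp add: divide_simps)
      finally show ?thesis .
    qed
    moreover have "2 * l / t + l / (1 + 3 * l) \<le> 1 - 1 / (1 + 6 * l + 6 * l\<^sup>2)"
    proof -
      \<comment> \<open>Coefficientwise in \<open>l\<close>: 3, 28, 78, 60 against 6, 48, 114,
        72.\<close>
      have "(2 * (1 + 3 * l) + t) * (1 + 6 * l + 6 * l\<^sup>2) \<le> 6 * (1 + l) * (t * (1 + 3 * l))"
        using l by (simp add: t_def power2_eq_square algebra_simps add_nonneg_nonneg)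
      moreover have "0 < 1 + 3 * l" "0 < 1 + 6 * l + 6 * l\<^sup>2" using l by (auto intro!: add_pos_pos)
      ultimately have "(2 * (1 + 3 * l) + t) / (t * (1 + 3 * l)) \<le> 6 * (1 + l) / (1 + 6 * l + 6 * l\<^sup>2)"
        using l pos by (simp add: divide_simps mult.commute)
      then have "l * ((2 * (1 + 3 * l) + t) / (t * (1 + 3 * l))) \<le> l * (6 * (1 + l) / (1 + 6 * l + 6 * l\<^sup>2))"
        using l by (intro mult_left_mono) auto
      moreover have "l * ((2 * (1 + 3 * l) + t) / (t * (1 + 3 * l))) = 2 * l / t + l / (1 + 3 * l)"
        using l pos by (simp add: add_frac_eq algebra_simps)
      moreover have "l * (6 * (1 + l) / (1 + 6 * l + 6 * l\<^sup>2)) = 1 - 1 / (1 + 6 * l + 6 * l\<^sup>2)"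
        using \<open>0 < 1 + 6 * l + 6 * l\<^sup>2\<close> by (simp add: field_simps power2_eq_square)
      ultimately show ?thesis by simp
    qed
    ultimately show ?thesis by simp
  qed
  define P where "P = 1 + 6 * l + 6 * l\<^sup>2"
  have P: "P > 0" using l by (auto simp: P_def intro!: add_pos_pos)
  have B_eq: "B = l\<^sup>2 * (1 - (a / \<gamma> + \<eta>))"
    using \<gamma> by (simp add: B_def field_simps)
  have "l\<^sup>2 * (1 / P) \<le> B"
    unfolding B_eq using ratio by (intro mult_left_mono) (auto simp: P_def)
  moreover have st: "1 - 2 * m = P / (s * t)"
    proof -
    have "P = s * t - 2 * l\<^sup>2"
      by (simp add: P_def s_def t_def power2_eq_square algebra_simps)
    then show ?thesis
      using pos by (simp add: m_def diff_divide_distrib)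
  qed
  ultimately have "l\<^sup>2 * (1 / P) * (P / (s * t)) \<le> B * (1 - 2 * m)"
    unfolding st using P pos by (intro mult_right_mono) auto
  then have "m \<le> B * (1 - 2 * m)"
    using P by (simp add: m_def)
  \<comment> \<open>The discriminant condition, equivalent to the preceding inequality.\<close>
  then have Bm: "m\<^sup>2 \<le> (B - m) * (1 / 2 - m)"
    by (simp add: power2_eq_square algebra_simps)
  have "0 \<le> 1 - (a / \<gamma> + \<eta>)"
    using ratio P unfolding P_def[symmetric] by (smt (verit) divide_pos_pos)
  then have "0 \<le> \<gamma> * (1 - (a / \<gamma> + \<eta>))" using \<gamma> by simp
  moreover have "\<gamma> * (1 - (a / \<gamma> + \<eta>)) = \<gamma> - a - \<gamma> * \<eta>"
    using \<gamma> by (simp add: right_diff_distrib distrib_left)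
  ultimately have "0 \<le> \<gamma> - a - \<gamma> * \<eta>" by simp
  then have \<Phi>B: "B * inner e e \<le> (\<gamma> - a - \<gamma> * \<eta>) * \<Phi>"
    using mult_left_mono[OF \<Phi>] by (simp add: B_def power2_norm_eq_inner mult.assoc)
  have "0 \<le> inner ((1 / 2 - m) *\<^sub>R U - m *\<^sub>R e) ((1 / 2 - m) *\<^sub>R U - m *\<^sub>R e)"
    by simp
  also have "\<dots> = (1 / 2 - m)\<^sup>2 * inner U U - 2 * m * (1 / 2 - m) * inner U e + m\<^sup>2 * inner e e"
    by (simp add: inner_diff_left inner_diff_right inner_commute power2_eq_square algebra_simps)
  also have "\<dots> \<le> (1 / 2 - m)\<^sup>2 * inner U U - 2 * m * (1 / 2 - m) * inner U e
      + (B - m) * (1 / 2 - m) * inner e e"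
    using Bm by (intro add_left_mono mult_right_mono) auto
  also have "\<dots> = (1 / 2 - m) * ((1 / 2 - m) * inner U U - 2 * m * inner U e + (B - m) * inner e e)"
    by (simp add: power2_eq_square field_simps)
  finally have quad: "0 \<le> (1 / 2 - m) * inner U U - 2 * m * inner U e + (B - m) * inner e e"
    using m by (simp add: zero_le_mult_iff)
  have "U + e = s *\<^sub>R (e + w)"
    by (simp add: U_def s_def algebra_simps)
  then have "(norm (U + e))\<^sup>2 = s\<^sup>2 * (norm (e + w))\<^sup>2"
    by (simp add: power_mult_distrib)
  then have "l\<^sup>2 * s / t * (norm (e + w))\<^sup>2 = m * (norm (U + e))\<^sup>2"
    using pos by (simp add: m_def power2_eq_square)
  also have "\<dots> = m * (inner U U + 2 * inner U e + inner e e)"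
    unfolding power2_norm_eq_inner by (simp add: inner_add_left inner_add_right inner_commute)
  finally have "energy l \<gamma> \<Phi> e w
      = (\<gamma> - a) * \<Phi> + inner U U / 2 - m * (inner U U + 2 * inner U e + inner e e)"
    by (simp add: energy_def U_def a_def s_def t_def power2_norm_eq_inner)
  then have "\<gamma> * \<eta> * \<Phi> \<le> energy l \<gamma> \<Phi> e w"
    using quad \<Phi>B by (simp add: algebra_simps)
  then show ?thesis by (simp add: \<eta>_def)
qed

section \<open>From a one-step inequality to geometric rates\<close>

text \<open>Weighting step \<open>k\<close> by \<open>R ^ k\<close> makes the energies telescope,
  and the surplus terms sum to at most \<open>E 0 / c\<close>.\<close>

lemma geometric_decay:
  fixes E G :: "nat \<Rightarrow> real"
  assumes R: "R > 0" and c: "c > 0" and nonneg: "\<And>k. 0 \<le> E k" "\<And>k. 0 \<le> G k"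
    and step: "\<And>k. R * E (Suc k) + c * G (Suc k) \<le> E k"
  shows "R ^ k * E k \<le> E 0" and "summable (\<lambda>k. R ^ k * G k)"
proof -
  have *: "R ^ k * E k + c * (\<Sum>j<k. R ^ j * G (Suc j)) \<le> E 0" for k
  proof (induction k)
    case (Suc k)
    have "R ^ k * (R * E (Suc k) + c * G (Suc k)) \<le> R ^ k * E k"
      using step[of k] R by (intro mult_left_mono) auto
    with Suc show ?case by (simp add: algebra_simps)
  qed simp
  have sum_nonneg: "0 \<le> (\<Sum>j<k. R ^ j * G (Suc j))" for k
    using R nonneg by (intro sum_nonneg) auto
  show "R ^ k * E k \<le> E 0"
    using *[of k] mult_nonneg_nonneg[OF less_imp_le[OF c] sum_nonneg[of k]] by linarith
  have "summable (\<lambda>j. R ^ j * G (Suc j))"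
  proof (rule summableI_nonneg_bounded)
    fix k
    have "0 \<le> R ^ k * E k" using R nonneg by simp
    with *[of k] have "c * (\<Sum>j<k. R ^ j * G (Suc j)) \<le> E 0" by linarith
    then show "(\<Sum>j<k. R ^ j * G (Suc j)) \<le> E 0 / c"
      using c by (simp add: field_simps)
  qed (use R nonneg in auto)
  \<comment> \<open>The surplus carries \<open>R ^ j\<close> at index \<open>j + 1\<close>; the
    factor \<open>R\<close> aligns the exponent before the initial term is added.\<close>
  from summable_mult[OF this, of R] show "summable (\<lambda>k. R ^ k * G k)"
    by (subst summable_Suc_iff[symmetric]) (simp add: mult.assoc)
qed

lemma summable_imp_smallo_powi:
  fixes G :: "nat \<Rightarrow> real"
  assumes "R > 0" and "summable (\<lambda>k. R ^ k * G k)"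
  shows "G \<in> o[sequentially](\<lambda>k. R powi (- int k))"
proof (rule smalloI_tendsto)
  have "(\<lambda>k. R ^ k * G k) \<longlonglongrightarrow> 0"
    using assms(2) by (rule summable_LIMSEQ_zero)
  then show "(\<lambda>k. G k / R powi (- int k)) \<longlonglongrightarrow> 0"
    by (simp add: power_int_minus field_simps)
  show "\<forall>\<^sub>F k in sequentially. R powi (- int k) \<noteq> 0"
    using assms(1) by simp
qed

section \<open>The iteration in rescaled variables, its initial energy and the rates\<close>

theorem theorem12:
  fixes f :: "'a::{real_inner, complete_space} \<Rightarrow> real"
    and \<mu> L h \<gamma> \<alpha> q \<rho> C fstar :: real
    and xstar :: 'a
    and x y :: "nat \<Rightarrow> 'a"
  assumes "\<mu> > 0" and "L > 0"
    and "strongly_convex \<mu> f" and "smooth_with L f"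
    and "\<forall>z. f xstar \<le> f z" and "fstar = f xstar"
    and "h = 1 / sqrt L" and "\<gamma> \<in> {1..2}" and "\<alpha> = 3 * sqrt (\<mu> * \<gamma> / 2)"
    and "\<forall>k. y (Suc k) = x k - h\<^sup>2 *\<^sub>R gradient f (x k)"
    and "\<forall>k. x (Suc k) = y (Suc k)
               + (1 / (1 + \<alpha> * h)) *\<^sub>R (y (Suc k) - y k)
               + (\<gamma> / (1 + \<alpha> * h) - 1) *\<^sub>R (y (Suc k) - x k)"
    and "y 0 = - (((\<gamma> - (1 / 3 * \<alpha> * h) / (1 + 2 / 3 * \<alpha> * h)) * h\<^sup>2) *\<^sub>R gradient f (x 0)) + x 0"
    and "q = \<mu> / L"
    and "\<rho> = sqrt (2 * q * \<gamma>) / (1 + sqrt (2 * q * \<gamma>))"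
    and "C = 1 / (2 - sqrt 2) * (3 + sqrt (2 / (q * \<gamma>)))
             * (\<mu> * (norm (x 0 - xstar))\<^sup>2 + (f (x 0) - fstar))"
  shows "(\<forall>k\<ge>1. f (y k) - fstar \<le> C * (1 + \<rho>) powi (- int k + 1))
       \<and> summable (\<lambda>k. (1 + \<rho>) ^ k * (norm (gradient f (x k)))\<^sup>2)
       \<and> (\<lambda>k. (norm (gradient f (x k)))\<^sup>2) \<in> o[sequentially](\<lambda>k. (1 + \<rho>) powi (- int k))"
proof -
  let ?g = "\<lambda>k. gradient f (x k)"
  have sc: "strongly_convex \<mu> f" "\<mu> \<ge> 0" "smooth_with L f" "L > 0" "\<forall>z. f xstar \<le> f z"
    using assms by auto
  have \<gamma>: "1 \<le> \<gamma>" "\<gamma> \<le> 2" using assms by auto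
  have h2: "h\<^sup>2 = 1 / L" using assms by (simp add: power_divide)
  have h0: "h > 0" using assms by simp
  \<comment> \<open>As \<open>l\<^sup>2 = q * \<gamma> / 2\<close>, this one parameter expresses
    \<open>\<alpha> * h\<close>, \<open>\<rho>\<close> and the root in \<open>C\<close>.\<close>
  define l where "l = h * sqrt (\<mu> * \<gamma> / 2)"
  have l0: "l > 0" using h0 \<gamma> assms(1) by (simp add: l_def)
  have l2: "l\<^sup>2 = h\<^sup>2 * (\<mu> * \<gamma> / 2)"
    using \<gamma> assms(1) by (simp add: l_def power_mult_distrib)
  have \<alpha>h: "\<alpha> * h = 3 * l" using assms(9) by (simp add: l_def)
  have rt: "sqrt (2 * q * \<gamma>) = 2 * l"
    using assms(13) l0 by (intro real_sqrt_unique) (auto simp: power_mult_distrib l2 h2)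
  have rt': "sqrt (2 / (q * \<gamma>)) = 1 / l"
    using assms(13) l0 by (intro real_sqrt_unique) (auto simp: power_divide l2 h2)
  define R where "R = (1 + 4 * l) / (1 + 2 * l)"
  have R: "1 + \<rho> = R"
    unfolding assms(14) rt R_def using l0 by (simp add: field_simps)
  have R0: "R > 0" using l0 by (simp add: R_def)
  have l2\<gamma>: "l\<^sup>2 / \<gamma> = h\<^sup>2 * (\<mu> / 2)" using \<gamma> by (simp add: l2)

  define G F w v d where "G = (\<lambda>k. h\<^sup>2 *\<^sub>R ?g k)" and "F = (\<lambda>k. h\<^sup>2 * (f (x k) - fstar))"
    and "w = (\<lambda>k. x (Suc k) - y (Suc k))" and "v = (\<lambda>k. x (Suc k) - x k)"
    and "d = (\<lambda>k. x k - xstar)"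
  define \<Phi> where "\<Phi> k = F k - (norm (G k))\<^sup>2 / 2" for k
  define E where "E k = energy l \<gamma> (\<Phi> k) (d k - G k) (w k)" for k
  have yG: "y (Suc k) = x k - G k" for k using assms(10) by (simp add: G_def)
  have wv: "w k = v k + G k" for k by (simp add: w_def v_def yG)
  have norm_G: "(norm (G k))\<^sup>2 = h\<^sup>2 * h\<^sup>2 * (norm (?g k))\<^sup>2" for k
    by (simp add: G_def power_mult_distrib power2_eq_square)

  \<comment> \<open>The \<open>-1\<close> in the last coefficient cancels the plain gradient step.
    At index \<open>Suc k\<close>, \<open>x - y\<close> is \<open>w k\<close>, which gives the
    formula for \<open>w'\<close> in \<open>energy_step\<close>.\<close>
  have rec: "(1 + 3 * l) *\<^sub>R v k = (x k - y k) - (1 + \<gamma>) *\<^sub>R G k" for k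
  proof -
    define b where "b = 1 / (1 + 3 * l)"
    have b: "(1 + 3 * l) * b = 1" using l0 by (simp add: b_def)
    have "v k = b *\<^sub>R ((x k - y k) - (1 + \<gamma>) *\<^sub>R G k)"
      using assms(11)[rule_format, of k] unfolding \<alpha>h v_def yG
      by (simp add: b_def algebra_simps)
    then have "(1 + 3 * l) *\<^sub>R v k = ((1 + 3 * l) * b) *\<^sub>R ((x k - y k) - (1 + \<gamma>) *\<^sub>R G k)"
      by simp
    then show ?thesis unfolding b by simp
  qed
  \<comment> \<open>The square subtracted in \<open>\<Phi>\<close> is \<open>h\<^sup>2\<close> times
    the decrease guaranteed by a gradient step.\<close>
  have \<Phi>_ge: "h\<^sup>2 * (f (y (Suc k)) - fstar) \<le> \<Phi> k" for k
  proof -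
    have "f (y (Suc k)) \<le> f (x k) - h\<^sup>2 * (norm (?g k))\<^sup>2 / 2"
      using gradient_step_decrease[OF sc(1-4), of "x k"] by (simp add: yG G_def h2)
    then have "h\<^sup>2 * (f (y (Suc k)) - fstar) \<le> h\<^sup>2 * (f (x k) - h\<^sup>2 * (norm (?g k))\<^sup>2 / 2 - fstar)"
      by (intro mult_left_mono) auto
    then show ?thesis
      by (simp add: \<Phi>_def F_def norm_G algebra_simps)
  qed
  have \<Phi>_growth: "l\<^sup>2 / \<gamma> * (norm (d k - G k))\<^sup>2 \<le> \<Phi> k" for k
  proof -
    have "h\<^sup>2 * (\<mu> / 2 * (norm (y (Suc k) - xstar))\<^sup>2) \<le> h\<^sup>2 * (f (y (Suc k)) - fstar)"
      using strongly_convex_growth[OF sc, of "y (Suc k)"] assms(6) by (intro mult_left_mono) auto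
    also have "y (Suc k) - xstar = d k - G k" by (simp add: yG d_def)
    also note \<Phi>_ge
    finally show ?thesis by (simp add: l2\<gamma> mult.assoc)
  qed
  have \<Phi>0: "0 \<le> \<Phi> k" for k
    using \<Phi>_growth[of k] \<gamma> by (smt (verit) divide_nonneg_nonneg mult_nonneg_nonneg zero_le_power2)
  define \<eta> where "\<eta> = (2 - sqrt 2) / (3 + 1 / l)"
  have "sqrt 2 < 2" using real_sqrt_less_mono[of 2 4] by simp
  then have \<eta>0: "\<eta> > 0" using l0 by (simp add: \<eta>_def add_pos_pos)
  have E_lower: "\<gamma> * \<eta> * \<Phi> k \<le> E k" for k
    unfolding E_def \<eta>_def by (rule energy_lower[OF l0 \<gamma>(1) \<Phi>_growth])
  then have E0: "0 \<le> E k" for k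
    using \<gamma> \<eta>0 \<Phi>0[of k] by (intro order.trans[OF _ E_lower]) auto

  have step: "R * E (Suc k) + 2 * l / (3 * \<gamma> * (1 + 4 * l)) * (norm (G (Suc k)))\<^sup>2 \<le> E k" for k
  proof -
    let ?j = "Suc k"
    have "R * energy l \<gamma> (F ?j - (norm (G ?j))\<^sup>2 / 2) (d ?j - G ?j) (v ?j + G ?j)
      + 2 * l / (3 * \<gamma> * (1 + 4 * l)) * (norm (G ?j))\<^sup>2
      \<le> energy l \<gamma> (F k - (norm (G k))\<^sup>2 / 2) (d ?j - w k) (w k)"
      unfolding R_def
    proof (rule energy_step[OF l0 \<gamma>])
      show "w k = (1 + 3 * l) *\<^sub>R v ?j + (1 + \<gamma>) *\<^sub>R G ?j"
        by (simp add: rec w_def)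
      \<comment> \<open>Cocoercivity between consecutive iterates, scaled by
        \<open>h\<^sup>2\<close>, becomes \<open>decr\<close>.\<close>
      have "h\<^sup>2 * (f (x ?j) + inner (?g ?j) (x k - x ?j) + (norm (?g ?j - ?g k))\<^sup>2 / (2 * L)) \<le> h\<^sup>2 * f (x k)"
        by (intro mult_left_mono subgradient_cocoercive[OF sc(1-4)]) auto
      moreover have "x k - x ?j = - (w k - G k)" by (simp add: w_def yG)
      moreover have "(norm (G ?j - G k))\<^sup>2 = h\<^sup>2 * ((norm (?g ?j - ?g k))\<^sup>2 / L)"
      proof -
        have "(norm (G ?j - G k))\<^sup>2 = h\<^sup>2 * (h\<^sup>2 * (norm (?g ?j - ?g k))\<^sup>2)"
          unfolding G_def scaleR_diff_right[symmetric] by (simp add: power_mult_distrib power2_eq_square)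
        then show ?thesis by (simp add: h2)
      qed
      ultimately show "F ?j - F k \<le> inner (G ?j) (w k - G k) - (norm (G ?j - G k))\<^sup>2 / 2"
        by (simp add: F_def G_def algebra_simps)
      have "h\<^sup>2 * (f (x ?j) - fstar + \<mu> / 2 * (norm (d ?j))\<^sup>2) \<le> h\<^sup>2 * inner (?g ?j) (d ?j)"
        using strongly_convex_lower[OF sc(1), of "x ?j" xstar] assms(6)
        by (intro mult_left_mono) (auto simp: d_def inner_diff_right)
      then show 1: "F ?j + l\<^sup>2 / \<gamma> * (norm (d ?j))\<^sup>2 \<le> inner (G ?j) (d ?j)"
        by (simp add: F_def G_def l2\<gamma> algebra_simps)
      \<comment> \<open>Quadratic growth at the minimizer replaces \<open>F\<close> in the previous
        bound and doubles the coefficient.\<close>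
      have "h\<^sup>2 * (\<mu> / 2 * (norm (d ?j))\<^sup>2) \<le> F ?j"
        unfolding F_def d_def
        using strongly_convex_growth[OF sc, of "x ?j"] assms(6) by (intro mult_left_mono) auto
      moreover have "2 * l\<^sup>2 / \<gamma> = 2 * (h\<^sup>2 * (\<mu> / 2))" by (simp add: l2\<gamma> flip: times_divide_eq_right)
      ultimately show "2 * l\<^sup>2 / \<gamma> * (norm (d ?j))\<^sup>2 \<le> inner (G ?j) (d ?j)"
        using 1 unfolding l2\<gamma> by simp
    qed
    moreover have "d ?j - w k = d k - G k" by (simp add: d_def w_def yG)
    ultimately show ?thesis by (simp only: E_def \<Phi>_def wv[of ?j])
  qed
  have c0: "0 < 2 * l / (3 * \<gamma> * (1 + 4 * l))" using l0 \<gamma> by simp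
  note decay = geometric_decay[where E = E and G = "\<lambda>k. (norm (G k))\<^sup>2", OF R0 c0 E0 zero_le_power2 step]

  define D where "D = \<mu> * (norm (d 0))\<^sup>2 + (f (x 0) - fstar)"
  have E_init: "E 0 \<le> \<gamma> * h\<^sup>2 * D"
  proof -
    \<comment> \<open>The correction in \<open>y 0\<close> equals \<open>l / (1 + 2 * l)\<close>, so
      the right side of \<open>rec\<close> acquires a factor \<open>1 + 3 * l\<close> that
      cancels.\<close>
    have "(1 + 2 * l) *\<^sub>R v 0 = - G 0"
    proof -
      have "x 0 - y 0 = (\<gamma> - l / (1 + 2 * l)) *\<^sub>R G 0"
        using assms(12) \<alpha>h by (simp add: G_def mult.assoc)
      then have "(1 + 3 * l) *\<^sub>R v 0 = ((\<gamma> - l / (1 + 2 * l)) - (1 + \<gamma>)) *\<^sub>R G 0"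
        by (simp only: rec scaleR_diff_left)
      also have "(\<gamma> - l / (1 + 2 * l)) - (1 + \<gamma>) = - (1 + l / (1 + 2 * l))" by simp
      also have "1 + l / (1 + 2 * l) = (1 + 3 * l) / (1 + 2 * l)"
        using l0 by (simp add: field_simps)
      finally have "(1 + 2 * l) *\<^sub>R ((1 + 3 * l) *\<^sub>R v 0)
          = (1 + 2 * l) *\<^sub>R ((- ((1 + 3 * l) / (1 + 2 * l))) *\<^sub>R G 0)" by simp
      also have "\<dots> = ((1 + 2 * l) * (- ((1 + 3 * l) / (1 + 2 * l)))) *\<^sub>R G 0"
        by (rule scaleR_scaleR)
      also have "(1 + 2 * l) * (- ((1 + 3 * l) / (1 + 2 * l))) = - (1 + 3 * l)"
        using l0 by simp
      finally have "(1 + 3 * l) *\<^sub>R ((1 + 2 * l) *\<^sub>R v 0) = (1 + 3 * l) *\<^sub>R (- G 0)"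
        by (simp only: scaleR_minus_left scaleR_minus_right scaleR_scaleR mult.commute)
      then show ?thesis using l0 by (simp only: scaleR_cancel_left) simp
    qed
    moreover have "(2 * l) *\<^sub>R (d 0 - G 0 + w 0) + w 0 = (2 * l) *\<^sub>R d 0 + ((1 + 2 * l) *\<^sub>R v 0 + G 0)"
      by (simp add: wv algebra_simps)
    ultimately have "(norm ((2 * l) *\<^sub>R (d 0 - G 0 + w 0) + w 0))\<^sup>2 / 2 = 2 * l\<^sup>2 * (norm (d 0))\<^sup>2"
      by (simp add: power_mult_distrib)
    moreover have "2 * l\<^sup>2 * (norm (d 0))\<^sup>2 = \<gamma> * h\<^sup>2 * (\<mu> * (norm (d 0))\<^sup>2)"
      by (simp add: l2)
    \<comment> \<open>The negative parts of the initial energy are simply discarded.\<close>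
    moreover have "0 \<le> 2 * l / (\<gamma> * (1 + 4 * l)) * \<Phi> 0"
      using l0 \<gamma> \<Phi>0 by (intro mult_nonneg_nonneg) auto
    moreover have "0 \<le> l\<^sup>2 * (1 + 2 * l) / (1 + 4 * l) * (norm (d 0 - G 0 + w 0))\<^sup>2"
      using l0 by simp
    moreover have "\<gamma> * \<Phi> 0 \<le> \<gamma> * h\<^sup>2 * (f (x 0) - fstar)"
      using \<gamma> by (simp add: \<Phi>_def F_def mult.assoc)
    ultimately show ?thesis
      by (simp add: E_def energy_def D_def distrib_left left_diff_distrib)
  qed
  have C: "C = D / \<eta>"
    unfolding assms(15) rt' D_def \<eta>_def d_def by (simp add: field_simps)

  have "f (y k) - fstar \<le> C * (1 + \<rho>) powi (- int k + 1)" if k: "k \<ge> 1" for k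
  proof -
    \<comment> \<open>\<open>\<Phi> m\<close> controls the gap at \<open>y (Suc m)\<close>, hence
      the exponent \<open>-k + 1\<close>; the factor \<open>\<gamma>\<close> in both energy bounds
      cancels, leaving \<open>D / \<eta> = C\<close>.\<close>
    obtain m where m: "k = Suc m" using k by (cases k) auto
    have "R ^ m * (\<gamma> * \<eta> * \<Phi> m) \<le> R ^ m * E m"
      using R0 E_lower by (intro mult_left_mono) auto
    also have "\<dots> \<le> \<gamma> * h\<^sup>2 * D" using decay(1) E_init by (rule order.trans)
    finally have "\<gamma> * (R ^ m * \<eta> * \<Phi> m) \<le> \<gamma> * (h\<^sup>2 * D)" by (simp add: algebra_simps)
    then have "R ^ m * \<eta> * \<Phi> m \<le> h\<^sup>2 * D" using \<gamma> by simp
    moreover have "R ^ m * \<eta> * (h\<^sup>2 * (f (y k) - fstar)) \<le> R ^ m * \<eta> * \<Phi> m"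
      unfolding m using R0 \<eta>0 \<Phi>_ge by (intro mult_left_mono) auto
    ultimately have "h\<^sup>2 * (R ^ m * \<eta> * (f (y k) - fstar)) \<le> h\<^sup>2 * D" by (simp add: algebra_simps)
    then have "R ^ m * \<eta> * (f (y k) - fstar) \<le> D" using h0 by simp
    then have "f (y k) - fstar \<le> D / \<eta> / R ^ m"
      using R0 \<eta>0 by (simp add: field_simps)
    then show ?thesis by (simp add: m C R power_int_minus divide_inverse)
  qed
  moreover have summ: "summable (\<lambda>k. R ^ k * (norm (?g k))\<^sup>2)"
  proof -
    have "summable (\<lambda>k. 1 / (h\<^sup>2 * h\<^sup>2) * (R ^ k * (norm (G k))\<^sup>2))"
      by (intro summable_mult decay(2))
    then show ?thesis using h0 by (simp add: norm_G)
  qed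
  ultimately show ?thesis
    using summable_imp_smallo_powi[OF R0 summ] by (simp add: R)
qed

end
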